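(* Let $q$ be an arbitrary prime power and $A=\mathbb{F}_q[t]$. Let $k\ge1$ and let $s_1,s_2$ be integers with $1\le s_1<q$ and $1\le s_2\le q$. Let $k_1,\dots,k_{s_1}$ and $l_1,\dots,l_{s_2}$ be integers with $0\le k_i<k$ and $0\le l_j<k$. Put $a=q^k-\sum_{i=1}^{s_1}q^{k_i}$ and $b=s_2q^k-\sum_{j=1}^{s_2}q^{l_j}$. Choose $s_1$ entries $k_1',\dots,k_{s_1}'$ from the list (with multiplicity) $k_1,\dots,k_{s_1},l_1,\dots,l_{s_2}$, and let $l_1',\dots,l_{s_2}'$ be the remaining $s_2$ entries. Put $a'=q^k-\sum_{i=1}^{s_1}q^{k_i'}$ and $b'=s_2q^k-\sum_{j=1}^{s_2}q^{l_j'}$. Then $\zeta(a,b)/\zeta(a',b')$ lies in $K=\mathbb{F}_q(t)$.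
   Context: $\mathbb{F}_q$ is a finite field with $q$ elements, $A=\mathbb{F}_q[t]$, $K=\mathbb{F}_q(t)$, and $K_\infty=\mathbb{F}_q((1/t))$. For positive integers $s_1,s_2$, the depth-two multizeta value is $$\zeta(s_1,s_2):=\sum\frac{1}{a_1^{s_1}a_2^{s_2}}\in K_\infty,$$ where the sum runs over all pairs of monic polynomials $a_1,a_2\in A$ with $\deg a_1>\deg a_2\ge 0$. "Rational" means belonging to $K$. *)

theory Defs
  imports
    "HOL-Analysis.Analysis"
    "HOL-Computational_Algebra.Formal_Laurent_Series"
begin

text \<open>
  The field with \<open>q\<close> elements is a type \<open>'a :: {field, finite}\<close> with \<open>CARD('a) = q\<close>, and
  \<open>A = 'a poly\<close>. The completion at infinity is \<open>'a fls\<close>, with the series variable \<open>fls_X\<close>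
  in the role of \<open>1/t\<close>; the library metric on \<open>'a fls\<close> is then the one belonging to the
  valuation at infinity. Polynomials in \<open>t\<close> are embedded by evaluation at \<open>t = fls_X_inv\<close>.
\<close>

definition poly_at_infty :: "'a::field poly \<Rightarrow> 'a fls" where
  "poly_at_infty f = poly (map_poly fls_const f) fls_X_inv"

definition rational_fls :: "'a::field fls set" where
  "rational_fls = {poly_at_infty f / poly_at_infty g | f g. g \<noteq> 0}"

text \<open>
  As \<open>infsum\<close> is \<open>0\<close> for families that are not summable, summability for positive
  exponents is proved below.
\<close>

definition zeta2 :: "nat \<Rightarrow> nat \<Rightarrow> 'a::{field,finite} fls" where
  "zeta2 s1 s2 =
     (\<Sum>\<^sub>\<infinity>(a1, a2) \<in> {(a1, a2). lead_coeff a1 = 1 \<and> lead_coeff a2 = 1 \<and> degree a1 > degree a2}.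
        1 / (poly_at_infty a1 ^ s1 * poly_at_infty a2 ^ s2))"

lemma poly_at_infty_nth:
  "fls_nth (poly_at_infty f) n = (if n \<le> 0 then coeff f (nat (- n)) else 0)"
proof -
  have deg: "degree (map_poly fls_const f) = degree f"
    by (rule degree_map_poly) simp
  have "poly_at_infty f = (\<Sum>i\<le>degree f. fls_const (coeff f i) * fls_X_inv ^ i)"
    unfolding poly_at_infty_def poly_altdef deg by (simp add: coeff_map_poly)
  hence "fls_nth (poly_at_infty f) n =
      (\<Sum>i\<le>degree f. coeff f i * (if n = - int i then 1 else 0))"
    by (simp add: fls_nth_sum)
  also have "\<dots> = (\<Sum>i\<le>degree f. if i = nat (- n) \<and> n \<le> 0 then coeff f i else 0)"
    by (rule sum.cong) auto
  also have "\<dots> = (if n \<le> 0 then coeff f (nat (- n)) else 0)"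
    by (auto simp: coeff_eq_0)
  finally show ?thesis .
qed

lemma poly_at_infty_eq_0_iff [simp]: "poly_at_infty f = 0 \<longleftrightarrow> f = 0"
proof
  assume "poly_at_infty f = 0"
  hence "coeff f i = 0" for i
    using poly_at_infty_nth[of f "- int i"] by simp
  thus "f = 0" by (simp add: poly_eq_iff)
qed (simp add: poly_at_infty_def)

lemma fls_subdegree_poly_at_infty: "fls_subdegree (poly_at_infty f) = - int (degree f)"
proof (cases "f = 0")
  case False
  thus ?thesis
    by (intro fls_subdegree_eqI) (auto simp: poly_at_infty_nth coeff_eq_0)
qed (simp add: poly_at_infty_def)

lemma finite_degree_le: "finite {f :: 'a::{field,finite} poly. degree f \<le> n}"
proof (rule finite_subset)
  show "{f :: 'a poly. degree f \<le> n} \<subseteq> Poly ` {xs. set xs \<subseteq> UNIV \<and> length xs \<le> Suc n}"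
  proof
    fix f :: "'a poly" assume "f \<in> {f. degree f \<le> n}"
    hence "length (coeffs f) \<le> Suc n"
      by (cases "f = 0") (auto simp: length_coeffs_degree)
    thus "f \<in> Poly ` {xs. set xs \<subseteq> UNIV \<and> length xs \<le> Suc n}"
      by (intro image_eqI[of _ _ "coeffs f"]) auto
  qed
  show "finite (Poly ` {xs :: 'a list. set xs \<subseteq> UNIV \<and> length xs \<le> Suc n})"
    by (intro finite_imageI finite_lists_length_le) simp
qed

lemma fls_summable_onI:
  fixes f :: "'i \<Rightarrow> 'a::field fls"
  assumes nonneg: "\<And>i. i \<in> I \<Longrightarrow> fls_subdegree (f i) \<ge> 0"
    and fin: "\<And>n::nat. finite {i \<in> I. fls_subdegree (f i) \<le> int n}"
  shows "f summable_on I"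
proof -
  define S where "S n = {i \<in> I. fls_subdegree (f i) \<le> int n}" for n
  have S: "finite (S n)" "S n \<subseteq> I" for n
    using fin[of n] by (auto simp: S_def)
  define g where "g = fps_to_fls (Abs_fps (\<lambda>n. \<Sum>i\<in>S n. fls_nth (f i) (int n)))"
  have coeff: "fls_nth (sum f F) m = fls_nth g m"
    if F: "finite F" "S n \<subseteq> F" "F \<subseteq> I" and m: "m \<le> int n" for F n m
  proof (cases "m < 0")
    case True
    have "fls_nth (f i) m = 0" if "i \<in> F" for i
      using nonneg[of i] that F True by (intro fls_eq0_below_subdegree) auto
    with True show ?thesis by (simp add: fls_nth_sum g_def)
  next
    case False
    then obtain k where k: "m = int k" "k \<le> n"
      using m by (metis nat_le_iff not_less nat_0_le)
    have "S k \<subseteq> S n" using k by (auto simp: S_def)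
    have "(\<Sum>i\<in>S k. fls_nth (f i) (int k)) = (\<Sum>i\<in>F. fls_nth (f i) (int k))"
    proof (rule sum.mono_neutral_left)
      show "finite F" "S k \<subseteq> F" using F \<open>S k \<subseteq> S n\<close> by auto
      show "\<forall>i\<in>F - S k. fls_nth (f i) (int k) = 0"
        using F by (auto simp: S_def intro!: fls_eq0_below_subdegree)
    qed
    thus ?thesis by (simp add: fls_nth_sum g_def k)
  qed
  have "(f has_sum g) I"
    unfolding has_sum_def
  proof (rule tendstoI)
    fix e :: real assume "e > 0"
    then obtain n where n: "(1/2) ^ n < e"
      using real_arch_pow_inv[of e "1/2"] by auto
    have "dist (sum f F) g < e" if F: "finite F" "S n \<subseteq> F" "F \<subseteq> I" for F
    proof (cases "sum f F = g")
      case False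
      hence "fls_subdegree (sum f F - g) \<ge> int n"
        by (intro fls_subdegree_geI) (use coeff[OF F] in auto)
      hence "dist (sum f F) g \<le> (1/2) ^ n"
        using False by (auto simp: dist_fls_def field_simps power_one_over le_nat_iff
            intro!: power_increasing)
      with n show ?thesis by simp
    qed (use \<open>e > 0\<close> in simp)
    thus "\<forall>\<^sub>F F in finite_subsets_at_top I. dist (sum f F) g < e"
      unfolding eventually_finite_subsets_at_top using S[of n] by blast
  qed
  thus ?thesis by (auto simp: summable_on_def)
qed

lemma zeta2_summable:
  assumes "s1 > 0"
  shows "(\<lambda>(a1, a2 :: 'a::{field,finite} poly).
            1 / (poly_at_infty a1 ^ s1 * poly_at_infty a2 ^ s2))
         summable_on {(a1, a2). lead_coeff a1 = 1 \<and> lead_coeff a2 = 1 \<and> degree a1 > degree a2}"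
    (is "?f summable_on ?I")
proof (rule fls_summable_onI)
  have sub: "fls_subdegree (?f (a1, a2)) = int (s1 * degree a1 + s2 * degree a2)"
    if "(a1, a2) \<in> ?I" for a1 a2
  proof -
    have nz: "a1 \<noteq> 0" "a2 \<noteq> 0" using that by auto
    hence "fls_subdegree (poly_at_infty a1 ^ s1 * poly_at_infty a2 ^ s2) =
        - int (s1 * degree a1 + s2 * degree a2)"
      by (simp add: fls_subdegree_pow fls_subdegree_poly_at_infty)
    thus ?thesis
      using nz by (simp add: fls_divide_subdegree)
  qed
  show "fls_subdegree (?f i) \<ge> 0" if "i \<in> ?I" for i
    using sub[of "fst i" "snd i"] that by (cases i) simp
  show "finite {i \<in> ?I. fls_subdegree (?f i) \<le> int n}" for n
  proof (rule finite_subset)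
    show "finite ({a :: 'a poly. degree a \<le> n} \<times> {a :: 'a poly. degree a \<le> n})"
      by (intro finite_cartesian_product finite_degree_le)
    show "{i \<in> ?I. fls_subdegree (?f i) \<le> int n} \<subseteq> {a. degree a \<le> n} \<times> {a. degree a \<le> n}"
    proof (clarify, goal_cases)
      case (1 a1 a2)
      have "degree a1 \<le> s1 * degree a1" using assms by simp
      moreover have "int (s1 * degree a1 + s2 * degree a2) \<le> int n"
        using 1 sub[of a1 a2] by simp
      hence "s1 * degree a1 + s2 * degree a2 \<le> n" by (simp only: of_nat_le_iff)
      ultimately have "degree a1 \<le> n" by linarith
      thus ?case using 1 by simp
    qed
  qed
qed

text \<open>
  The differences \<open>m * q ^ k - (\<Sum>x\<leftarrow>xs. q ^ x)\<close> used as exponents are not truncated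
  and are positive.
\<close>

lemma sum_list_powers_less:
  fixes q k m :: nat
  assumes "q > 0" "k \<ge> 1" "\<And>x. x \<in> set xs \<Longrightarrow> x < k" "length xs < m * q"
  shows "(\<Sum>x\<leftarrow>xs. q ^ x) < m * q ^ k"
proof -
  have "(\<Sum>x\<leftarrow>xs. q ^ x) \<le> (\<Sum>x\<leftarrow>xs. q ^ (k - 1))"
    using assms(1,3) by (intro sum_list_mono power_increasing) fastforce+
  also have "\<dots> = length xs * q ^ (k - 1)" by (simp add: sum_list_triv)
  also have "\<dots> < m * q * q ^ (k - 1)" using assms(1,4) by simp
  also have "\<dots> = m * q ^ k" using assms(2) by (cases k) simp_all
  finally show ?thesis .
qed

end

theory Submission
  imports Defs
begin

text \<open>
  Put \<open>\<theta> = t ^ (q ^ k)\<close>. For a polynomial \<open>p\<close> over the finite field, \<open>p(t) ^ (q ^ m) = p(t ^ (q ^ m))\<close>;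
  interpolating at the nodes \<open>\<theta> ^ (q ^ j)\<close>, \<open>j < d\<close>, makes this a polynomial of degree at most
  \<open>q ^ (d - 1)\<close> in \<open>w = p(\<theta>)\<close>, uniformly in \<open>p\<close> of degree below \<open>d\<close> (or monic of degree \<open>d\<close>).
  A polynomial of degree less than \<open>|W| - 1\<close> sums to zero over a translate \<open>W\<close> of a finite additive
  group, so the power sums over monic polynomials of degree \<open>d\<close>, and of degree below \<open>d\<close>, are
  products over the lists \<open>ks\<close> and \<open>ls\<close>: only the constant terms survive. Up to the factor
  \<open>t ^ (q ^ l) - \<theta>\<close> for each entry \<open>l\<close> of \<open>ls\<close>, and a factor depending only on \<open>d\<close>, the
  factors for \<open>ks\<close> and \<open>ls\<close> have the same form. Hence \<open>zeta2 a b\<close> times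
  the product of these \<open>t ^ (q ^ l) - \<theta>\<close> is symmetric in all the entries. It is nonzero because the
  term of degree \<open>d = 1\<close> strictly dominates the others.
\<close>

subsection \<open>Finite fields and interpolation\<close>

text \<open>Multiplication by a nonzero \<open>c\<close> permutes the nonzero elements; comparing
  their product before and after gives \<open>c ^ (q - 1) = 1\<close>.\<close>

lemma finite_field_power_card:
  fixes c :: "'a::{field,finite}"
  shows "c ^ CARD('a) = c"
proof (cases "c = 0")
  case False
  let ?U = "UNIV - {0 :: 'a}"
  have "bij_betw ((*) c) ?U ?U"
    using False by (intro bij_betwI[where g = "\<lambda>x. x / c"]) auto
  hence "prod (\<lambda>x. x) ?U = (\<Prod>x\<in>?U. c * x)"
    by (intro prod.reindex_bij_betw[symmetric])
  also have "\<dots> = c ^ (CARD('a) - 1) * prod (\<lambda>x. x) ?U"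
    by (simp add: prod.distrib)
  finally have "c ^ (CARD('a) - 1) = 1"
    by simp
  hence "c * c ^ (CARD('a) - 1) = c"
    by simp
  thus ?thesis
    by (metis Suc_diff_1 power_Suc zero_less_card_finite)
qed simp

lemma finite_field_power_card_power:
  fixes c :: "'a::{field,finite}"
  shows "c ^ (CARD('a) ^ n) = c"
  by (induction n) (simp_all add: power_mult finite_field_power_card mult.commute)

lemma two_le_card_field: "2 \<le> CARD('a::{field,finite})"
  using card_mono[of "UNIV :: 'a set" "{0, 1}"] by simp

text \<open>The polynomial \<open>(1 + X) ^ q - 1 - X ^ q\<close> has degree below \<open>q\<close> and vanishes on the
  whole field, so its coefficients are zero. This gives the additivity of the Frobenius map
  without knowing that \<open>q\<close> is a prime power.\<close>

lemma finite_field_of_nat_card_choose: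
  assumes "0 < i" "i < CARD('a::{field,finite})"
  shows "of_nat (CARD('a) choose i) = (0 :: 'a)"
proof -
  let ?q = "CARD('a)"
  define p :: "'a poly" where "p = (\<Sum>i\<in>{1..<?q}. monom (of_nat (?q choose i)) i)"
  have "poly p c = 0" for c
  proof -
    have "{..?q} = insert 0 (insert ?q {1..<?q})"
      by auto
    hence "(c + 1) ^ ?q = poly p c + c ^ ?q + 1"
      unfolding p_def binomial_ring[of c 1] by (simp add: poly_sum poly_monom)
    thus ?thesis
      by (simp add: finite_field_power_card)
  qed
  moreover have "degree p < ?q"
    unfolding p_def by (intro degree_sum_less) (auto intro: le_less_trans[OF degree_monom_le])
  ultimately have "p = 0"
    by (intro poly_eqI_degree[of UNIV]) auto
  moreover have "coeff p i = of_nat (?q choose i)"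
    using assms by (simp add: p_def coeff_sum)
  ultimately show ?thesis by simp
qed

text \<open>For a single \<open>q\<close>-th power the inner binomial coefficients vanish in the
  field, hence also in the Laurent series; the general case iterates this.\<close>

lemma fls_add_power_card:
  fixes x y :: "'a::{field,finite} fls"
  shows "(x + y) ^ (CARD('a) ^ n) = x ^ (CARD('a) ^ n) + y ^ (CARD('a) ^ n)"
proof -
  let ?q = "CARD('a)"
  have one: "(x + y) ^ ?q = x ^ ?q + y ^ ?q" for x y :: "'a fls"
  proof -
    have "(of_nat (?q choose i) :: 'a fls) = 0" if "0 < i" "i < ?q" for i
      using finite_field_of_nat_card_choose[OF that] by (simp add: fls_of_nat)
    hence "(\<Sum>i\<in>{1..<?q}. of_nat (?q choose i) * x ^ i * y ^ (?q - i)) = 0"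
      by (intro sum.neutral) auto
    moreover have "{..?q} = insert 0 (insert ?q {1..<?q})"
      by auto
    ultimately show ?thesis
      unfolding binomial_ring by (simp add: add.commute)
  qed
  show ?thesis
    by (induction n arbitrary: x y) (simp_all add: power_mult one)
qed

text \<open>Both sides have degree below \<open>card I\<close> and agree at the
  \<open>card I\<close> distinct nodes.\<close>

lemma lagrange_interpolation:
  fixes p :: "'b::field poly"
  assumes fin: "finite I" and inj: "inj_on x I" and deg: "degree p < card I"
  shows "p = (\<Sum>i\<in>I. smult (poly p (x i) / (\<Prod>j\<in>I-{i}. x i - x j)) (\<Prod>j\<in>I-{i}. [:- x j, 1:]))"
    (is "p = ?r")
proof (rule poly_eqI_degree)
  show "card (x ` I) > degree p"
    using deg inj by (simp add: card_image)
  have "degree (\<Prod>j\<in>I-{i}. [:- x j, 1:]) < card I" if "i \<in> I" for i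
    using fin that card_gt_0_iff[of I] by (subst degree_prod_sum_eq) auto
  hence "degree ?r < card I"
    using deg by (intro degree_sum_less) (auto intro: le_less_trans[OF degree_smult_le])
  thus "card (x ` I) > degree ?r"
    using inj by (simp add: card_image)
next
  fix y assume "y \<in> x ` I"
  then obtain l where l: "l \<in> I" "y = x l" by auto
  have "poly ?r y = (\<Sum>i\<in>I. poly p (x i) / (\<Prod>j\<in>I-{i}. x i - x j) * (\<Prod>j\<in>I-{i}. x l - x j))"
    by (simp add: poly_sum poly_prod l)
  also have "\<dots> = (\<Sum>i\<in>I. if i = l then poly p (x l) else 0)"
  proof (rule sum.cong, goal_cases)
    case (2 i)
    show ?case
    proof (cases "i = l")
      case True
      have "(\<Prod>j\<in>I-{l}. x l - x j) \<noteq> 0"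
        using fin inj l by (auto simp: inj_on_def)
      thus ?thesis using True by simp
    next
      case False
      hence "(\<Prod>j\<in>I-{i}. x l - x j) = 0"
        using fin l by (intro prod_zero) auto
      thus ?thesis using False by simp
    qed
  qed simp
  also have "\<dots> = poly p y"
    using fin l by simp
  finally show "poly p y = poly ?r y" ..
qed

text \<open>Compare coefficients of degree \<open>card I - 1\<close> in the Lagrange formula for
  \<open>P\<close>. The coset condition makes all denominators equal, so the right side is the sum
  in question divided by a nonzero constant; the left side is zero because \<open>P\<close> has
  smaller degree.\<close>

lemma sum_poly_additive_coset_eq_0:
  fixes P :: "'b::field poly"
  assumes fin: "finite I" and inj: "inj_on x I" and coset: "\<And>i. i \<in> I \<Longrightarrow> (\<lambda>j. x i - x j) ` I = V"
    and deg: "degree P + 1 < card I"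
  shows "(\<Sum>i\<in>I. poly P (x i)) = 0"
proof -
  define c where "c = prod (\<lambda>v. v) (V - {0})"
  define n where "n = card I - 1"
  \<comment> \<open>The differences run through the nonzero elements of \<open>V\<close>, whichever
    \<open>i\<close> is chosen.\<close>
  have prod: "(\<Prod>j\<in>I-{i}. x i - x j) = c" if "i \<in> I" for i
  proof -
    have "inj_on (\<lambda>j. x i - x j) (I - {i})"
      using inj by (auto simp: inj_on_def)
    moreover have "(\<lambda>j. x i - x j) ` (I - {i}) = V - {0}"
      using coset[OF that] inj that by (auto simp: inj_on_def)
    ultimately show ?thesis
      unfolding c_def by (metis (no_types, lifting) prod.reindex_cong)
  qed
  have coeff: "coeff (\<Prod>j\<in>I-{i}. [:- x j, 1:]) n = 1" if "i \<in> I" for i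
  proof -
    have "degree (\<Prod>j\<in>I-{i}. [:- x j, 1:]) = n"
      using that fin by (subst degree_prod_sum_eq) (auto simp: n_def)
    moreover have "lead_coeff (\<Prod>j\<in>I-{i}. [:- x j, 1:]) = 1"
      by (simp add: lead_coeff_prod)
    ultimately show ?thesis by simp
  qed
  obtain i0 where "i0 \<in> I"
    using deg by (metis card.empty ex_in_conv not_less_zero)
  have "c \<noteq> 0"
    using prod[OF \<open>i0 \<in> I\<close>] fin inj \<open>i0 \<in> I\<close> by (force simp: inj_on_def)
  have "0 = coeff P n"
    using deg by (simp add: n_def coeff_eq_0)
  also have "\<dots> = (\<Sum>i\<in>I. poly P (x i) / (\<Prod>j\<in>I-{i}. x i - x j) * coeff (\<Prod>j\<in>I-{i}. [:- x j, 1:]) n)"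
    using deg by (subst lagrange_interpolation[OF fin inj, of P]) (simp_all add: coeff_sum)
  also have "\<dots> = (\<Sum>i\<in>I. poly P (x i)) / c"
    by (simp add: prod coeff sum_divide_distrib)
  finally show ?thesis
    using \<open>c \<noteq> 0\<close> by simp
qed

section \<open>The embedding of polynomials and the Frobenius map\<close>

lemma poly_at_infty_0 [simp]: "poly_at_infty 0 = 0"
  by simp

lemma poly_at_infty_pCons: "poly_at_infty (pCons c p) = fls_const c + fls_X_inv * poly_at_infty p"
  by (cases "pCons c p = 0") (simp_all add: poly_at_infty_def map_poly_pCons)

lemma poly_at_infty_1 [simp]: "poly_at_infty 1 = 1"
  by (simp add: one_pCons poly_at_infty_pCons)

lemma poly_at_infty_X: "poly_at_infty [:0, 1:] = fls_X_inv"
  by (simp add: poly_at_infty_pCons)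

lemma poly_at_infty_add: "poly_at_infty (p + r) = poly_at_infty p + poly_at_infty r"
  by (rule fls_eqI) (simp add: poly_at_infty_nth)

lemma poly_at_infty_diff: "poly_at_infty (p - r) = poly_at_infty p - poly_at_infty r"
  by (rule fls_eqI) (simp add: poly_at_infty_nth)

lemma poly_at_infty_smult: "poly_at_infty (smult c p) = fls_const c * poly_at_infty p"
  by (rule fls_eqI) (simp add: poly_at_infty_nth)

lemma poly_at_infty_mult: "poly_at_infty (p * r) = poly_at_infty p * poly_at_infty r"
  by (induction p)
     (simp_all add: poly_at_infty_add poly_at_infty_smult poly_at_infty_pCons algebra_simps)

lemma poly_at_infty_power: "poly_at_infty (p ^ n) = poly_at_infty p ^ n"
  by (induction n) (simp_all add: poly_at_infty_mult)

lemma poly_at_infty_prod_list: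
  "poly_at_infty (\<Prod>x\<leftarrow>xs. f x) = (\<Prod>x\<leftarrow>xs. poly_at_infty (f x))"
  by (induction xs) (simp_all add: poly_at_infty_mult)

definition t_pow :: "nat \<Rightarrow> 'a::{field,finite} fls" where
  "t_pow m = fls_X_inv ^ (CARD('a) ^ m)"

text \<open>The power map is additive and fixes the coefficients, so it only replaces
  \<open>t\<close> by its own power.\<close>

lemma poly_at_infty_frobenius:
  fixes p :: "'a::{field,finite} poly"
  shows "poly_at_infty p ^ (CARD('a) ^ m) = poly (map_poly fls_const p) (t_pow m)"
proof (induction p)
  case (pCons c p)
  have "fls_const c ^ (CARD('a) ^ m) = fls_const c"
    by (simp add: finite_field_power_card_power flip: fls_const_power)
  thus ?case
    using pCons by (simp add: poly_at_infty_pCons fls_add_power_card power_mult_distrib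
        t_pow_def map_poly_pCons)
qed (simp add: power_0_left)

lemma fls_diff_power_card:
  fixes x y :: "'a::{field,finite} fls"
  shows "(x - y) ^ (CARD('a) ^ n) = x ^ (CARD('a) ^ n) - y ^ (CARD('a) ^ n)"
  using fls_add_power_card[of "x - y" y n] by simp

lemma of_nat_card_fls: "of_nat CARD('a::{field,finite}) = (0 :: 'a fls)"
  using finite_field_of_nat_card_choose[of 1, where ?'a = 'a] two_le_card_field[where ?'a = 'a]
  by (simp add: fls_of_nat)

section \<open>Polynomials of bounded degree as an additive group, monic polynomials as its
  translates\<close>

definition polys_below :: "nat \<Rightarrow> 'a::field poly set" where
  "polys_below d = {p. \<forall>i\<ge>d. coeff p i = 0}"

definition monics :: "nat \<Rightarrow> 'a::field poly set" where
  "monics d = {p. lead_coeff p = 1 \<and> degree p = d}"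

definition monics_below :: "nat \<Rightarrow> 'a::field poly set" where
  "monics_below d = {p. lead_coeff p = 1 \<and> degree p < d}"

lemma polys_below_diff: "p \<in> polys_below d \<Longrightarrow> r \<in> polys_below d \<Longrightarrow> p - r \<in> polys_below d"
  by (simp add: polys_below_def)

text \<open>The case \<open>p = 0\<close> is separate because \<open>degree 0 = 0\<close>: the group
  for \<open>d = 0\<close> is \<open>{0}\<close>, not empty.\<close>

lemma polys_below_iff_degree: "p \<in> polys_below d \<longleftrightarrow> p = 0 \<or> degree p < d"
proof
  assume p: "p \<in> polys_below d"
  show "p = 0 \<or> degree p < d"
  proof (rule ccontr)
    assume "\<not> ?thesis"
    hence "lead_coeff p = 0" "p \<noteq> 0" using p by (auto simp: polys_below_def)
    thus False by simp
  qed
qed (auto simp: polys_below_def coeff_eq_0)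

lemma polys_below_Suc: "polys_below (Suc d) = (\<lambda>(c, p). pCons c p) ` (UNIV \<times> polys_below d)"
proof (intro set_eqI iffI)
  fix p :: "'a poly" assume "p \<in> polys_below (Suc d)"
  moreover obtain c r where "p = pCons c r" by (cases p)
  ultimately show "p \<in> (\<lambda>(c, p). pCons c p) ` (UNIV \<times> polys_below d)"
    by (force simp: polys_below_def)
qed (auto simp: polys_below_def coeff_pCons split: nat.splits)

lemma finite_card_polys_below:
  "finite (polys_below d :: 'a::{field,finite} poly set) \<and>
   card (polys_below d :: 'a poly set) = CARD('a) ^ d"
proof (induction d)
  case 0
  have "polys_below 0 = {0 :: 'a poly}"
    by (auto simp: polys_below_def poly_eq_iff)
  thus ?case by simp
next
  case (Suc d)
  have "inj_on (\<lambda>(c, p). pCons c p) (UNIV \<times> polys_below d :: ('a \<times> 'a poly) set)"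
    by (auto simp: inj_on_def)
  thus ?case
    using Suc by (simp add: polys_below_Suc card_image card_cartesian_product)
qed

lemmas finite_polys_below [simp] = finite_card_polys_below[THEN conjunct1]
lemmas card_polys_below = finite_card_polys_below[THEN conjunct2]

lemma monics_diff:
  assumes "p \<in> monics d" "r \<in> monics d"
  shows "p - r \<in> polys_below d"
proof -
  have "coeff p i = coeff r i" if "i \<ge> d" for i
    using assms that by (cases "i = d") (auto simp: monics_def coeff_eq_0)
  thus ?thesis by (simp add: polys_below_def)
qed

lemma monics_diff_polys_below:
  assumes p: "p \<in> monics d" and r: "r \<in> polys_below d"
  shows "p - r \<in> monics d"
proof -
  have lead: "coeff (p - r) d = 1"
    using p r by (auto simp: monics_def polys_below_def)
  have "coeff (p - r) i = 0" if "i > d" for i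
    using p r that by (simp add: monics_def polys_below_def coeff_eq_0)
  hence "degree (p - r) \<le> d"
    by (intro degree_le) auto
  moreover have "degree (p - r) \<ge> d"
    using lead by (intro le_degree) simp
  ultimately show ?thesis
    using lead by (auto simp: monics_def)
qed

lemma monom_in_monics: "monom 1 d \<in> monics d"
  by (simp add: monics_def degree_monom_eq)

lemma bij_betw_polys_below_monics: "bij_betw (\<lambda>r. monom 1 d - r) (polys_below d) (monics d)"
  by (rule bij_betwI[where g = "\<lambda>r. monom 1 d - r"])
     (auto intro: monics_diff monics_diff_polys_below monom_in_monics)

lemma finite_monics [simp]: "finite (monics d :: 'a::{field,finite} poly set)"
  using bij_betw_finite[OF bij_betw_polys_below_monics] finite_polys_below by blast

lemma card_monics: "card (monics d :: 'a::{field,finite} poly set) = CARD('a) ^ d"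
  using bij_betw_same_card[OF bij_betw_polys_below_monics] card_polys_below by metis

lemma monics_below_Suc: "monics_below (Suc d) = monics_below d \<union> monics d"
  by (auto simp: monics_below_def monics_def)

lemma monics_below_0 [simp]: "monics_below 0 = {}"
  by (simp add: monics_below_def)

lemma monics_below_disjoint: "monics_below d \<inter> monics d = {}"
  by (auto simp: monics_below_def monics_def)

lemma finite_monics_below [simp]: "finite (monics_below d :: 'a::{field,finite} poly set)"
  by (induction d) (simp_all add: monics_below_Suc)

lemma inj_frobenius_poly_at_infty:
  "inj_on (\<lambda>p. poly_at_infty p ^ (CARD('a) ^ k)) (S :: 'a::{field,finite} poly set)"
proof (rule inj_onI)
  fix p r :: "'a poly"
  assume "poly_at_infty p ^ (CARD('a) ^ k) = poly_at_infty r ^ (CARD('a) ^ k)"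
  hence "poly_at_infty (p - r) ^ (CARD('a) ^ k) = 0"
    by (simp add: poly_at_infty_diff fls_diff_power_card)
  thus "p = r" by simp
qed

text \<open>By additivity of the Frobenius map the points form an additive group with
  \<open>q ^ d\<close> elements.\<close>

lemma sum_poly_polys_below_eq_0:
  fixes P :: "'a::{field,finite} fls poly"
  assumes "degree P + 1 < CARD('a) ^ d"
  shows "(\<Sum>p\<in>polys_below d. poly P (poly_at_infty p ^ (CARD('a) ^ k))) = 0"
proof (rule sum_poly_additive_coset_eq_0)
  let ?x = "\<lambda>p :: 'a poly. poly_at_infty p ^ (CARD('a) ^ k)"
  fix r :: "'a poly" assume r: "r \<in> polys_below d"
  have "(\<lambda>p. ?x r - ?x p) ` polys_below d = ?x ` (\<lambda>p. r - p) ` polys_below d"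
    by (simp add: image_image poly_at_infty_diff fls_diff_power_card)
  also have "(\<lambda>p. r - p) ` polys_below d = polys_below d"
    using r by (intro bij_betw_imp_surj_on bij_betwI[where g = "\<lambda>p. r - p"])
      (auto intro: polys_below_diff)
  finally show "(\<lambda>p. ?x r - ?x p) ` polys_below d = ?x ` polys_below d" .
qed (use assms in \<open>simp_all add: card_polys_below inj_frobenius_poly_at_infty\<close>)

text \<open>The points form a translate of the group belonging to
  \<open>polys_below d\<close>.\<close>

lemma sum_poly_monics_eq_0:
  fixes P :: "'a::{field,finite} fls poly"
  assumes "degree P + 1 < CARD('a) ^ d"
  shows "(\<Sum>p\<in>monics d. poly P (poly_at_infty p ^ (CARD('a) ^ k))) = 0"
proof (rule sum_poly_additive_coset_eq_0)
  let ?x = "\<lambda>p :: 'a poly. poly_at_infty p ^ (CARD('a) ^ k)"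
  fix r :: "'a poly" assume r: "r \<in> monics d"
  have "(\<lambda>p. ?x r - ?x p) ` monics d = ?x ` (\<lambda>p. r - p) ` monics d"
    by (simp add: image_image poly_at_infty_diff fls_diff_power_card)
  also have "(\<lambda>p. r - p) ` monics d = polys_below d"
    using r by (intro bij_betw_imp_surj_on bij_betwI[where g = "\<lambda>p. r - p"])
      (auto intro: monics_diff monics_diff_polys_below)
  finally show "(\<lambda>p. ?x r - ?x p) ` monics d = ?x ` polys_below d" .
qed (use assms in \<open>simp_all add: card_monics inj_frobenius_poly_at_infty\<close>)

section \<open>Interpolation at the nodes \<open>t_pow (k + j)\<close>\<close>

lemma fls_subdegree_t_pow [simp]:
  "fls_subdegree (t_pow m :: 'a::{field,finite} fls) = - int (CARD('a) ^ m)"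
  by (simp add: t_pow_def fls_subdegree_pow)

lemma t_pow_eq_iff [simp]: "t_pow m = (t_pow n :: 'a::{field,finite} fls) \<longleftrightarrow> m = n"
proof
  assume "t_pow m = (t_pow n :: 'a fls)"
  hence "fls_subdegree (t_pow m :: 'a fls) = fls_subdegree (t_pow n :: 'a fls)" by simp
  thus "m = n"
    using two_le_card_field[where ?'a = 'a] by (simp add: power_inject_exp)
qed simp

lemma fls_subdegree_t_pow_diff:
  assumes "m < n"
  shows "fls_subdegree (t_pow m - t_pow n :: 'a::{field,finite} fls) = - int (CARD('a) ^ n)"
proof -
  have "CARD('a) ^ m < CARD('a) ^ n"
    using assms two_le_card_field[where ?'a = 'a] by (intro power_strict_increasing) auto
  hence "fls_subdegree (t_pow n :: 'a fls) < fls_subdegree (t_pow m :: 'a fls)"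
    by (simp del: of_nat_power)
  thus ?thesis
    by (subst fls_subdegree_diff_eq2) (auto simp: t_pow_def)
qed

text \<open>The value at \<open>t_pow m\<close> of the monic polynomial of degree \<open>d\<close>
  with the roots \<open>t_pow (k + i)\<close>, \<open>i < d\<close>.\<close>

definition node_product :: "nat \<Rightarrow> nat \<Rightarrow> nat \<Rightarrow> 'a::{field,finite} fls" where
  "node_product k d m = (\<Prod>i<d. t_pow m - t_pow (k + i))"

text \<open>The value at \<open>t_pow m\<close> of the \<open>j\<close>-th Lagrange basis polynomial
  for the same nodes.\<close>

definition lagrange_basis :: "nat \<Rightarrow> nat \<Rightarrow> nat \<Rightarrow> nat \<Rightarrow> 'a::{field,finite} fls" where
  "lagrange_basis k d m j =
     (\<Prod>i\<in>{..<d}-{j}. (t_pow m - t_pow (k + i)) / (t_pow (k + j) - t_pow (k + i)))"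

lemma poly_t_pow_interpolation:
  fixes p :: "'a::{field,finite} fls poly"
  assumes "degree p < d"
  shows "poly p (t_pow m) = (\<Sum>j<d. lagrange_basis k d m j * poly p (t_pow (k + j)))"
proof -
  have inj: "inj_on (\<lambda>j. t_pow (k + j) :: 'a fls) {..<d}"
    by (auto simp: inj_on_def)
  show ?thesis
    by (subst lagrange_interpolation[OF _ inj, of p])
       (use assms in \<open>simp_all add: poly_sum poly_prod lagrange_basis_def prod_dividef
          divide_simps mult_ac\<close>)
qed

lemma poly_at_infty_frobenius_add:
  fixes p :: "'a::{field,finite} poly"
  shows "(poly_at_infty p ^ (CARD('a) ^ k)) ^ (CARD('a) ^ j) =
    poly (map_poly fls_const p) (t_pow (k + j))"
  by (simp flip: poly_at_infty_frobenius power_mult power_add)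

text \<open>The value of \<open>p\<close> at the node \<open>t_pow (k + j)\<close> is the
  \<open>q ^ j\<close>-th power of \<open>w = poly_at_infty p ^ (q ^ k)\<close>, so the right side
  is a polynomial in \<open>w\<close> whose coefficients do not depend on \<open>p\<close>.\<close>

lemma power_card_interpolation_polys_below:
  fixes p :: "'a::{field,finite} poly"
  assumes p: "p \<in> polys_below d" and d: "d \<ge> 1"
  shows "poly_at_infty p ^ (CARD('a) ^ m) =
    (\<Sum>j<d. lagrange_basis k d m j * (poly_at_infty p ^ (CARD('a) ^ k)) ^ (CARD('a) ^ j))"
proof -
  have "degree (map_poly fls_const p) < d"
    using p d by (subst degree_map_poly) (auto simp: polys_below_iff_degree)
  from poly_t_pow_interpolation[OF this] show ?thesis
    unfolding poly_at_infty_frobenius_add by (simp only: poly_at_infty_frobenius)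
qed

text \<open>Subtracting the monic node polynomial lowers the degree below \<open>d\<close> and
  changes no value at a node. As a polynomial in \<open>w\<close>, the right side has constant term
  \<open>node_product k d m\<close>.\<close>

lemma power_card_interpolation_monics:
  fixes p :: "'a::{field,finite} poly"
  assumes p: "p \<in> monics d" and d: "d \<ge> 1"
  shows "poly_at_infty p ^ (CARD('a) ^ m) = node_product k d m +
    (\<Sum>j<d. lagrange_basis k d m j * (poly_at_infty p ^ (CARD('a) ^ k)) ^ (CARD('a) ^ j))"
proof -
  let ?f = "map_poly fls_const p" and ?g = "\<Prod>i<d. [:- t_pow (k + i), 1:] :: 'a fls poly"
  have "degree ?f = d" "lead_coeff ?f = 1"
    using p by (auto simp: monics_def degree_map_poly coeff_map_poly)
  moreover have "degree ?g = d"
    by (simp add: degree_prod_sum_eq)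
  moreover have "lead_coeff ?g = 1"
    by (subst lead_coeff_prod) simp
  ultimately have "?f \<in> monics d" "?g \<in> monics d"
    by (simp_all add: monics_def)
  hence "degree (?f - ?g) < d"
    using monics_diff[of ?f d ?g] d by (auto simp: polys_below_iff_degree)
  from poly_t_pow_interpolation[OF this, of m k]
  have "poly ?f (t_pow m) - poly ?g (t_pow m) =
    (\<Sum>j<d. lagrange_basis k d m j * (poly ?f (t_pow (k + j)) - poly ?g (t_pow (k + j))))"
    by simp
  moreover have "poly ?g (t_pow (k + j)) = 0" if "j < d" for j
    using that by (auto simp: poly_prod)
  moreover have "poly ?g (t_pow m) = node_product k d m"
    by (simp add: poly_prod node_product_def)
  ultimately show ?thesis
    unfolding poly_at_infty_frobenius_add by (simp add: poly_at_infty_frobenius algebra_simps)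
qed

subsection \<open>Power sums over monic polynomials\<close>

lemma degree_prod_list_le_const:
  assumes "\<And>x. x \<in> set xs \<Longrightarrow> degree (f x) \<le> n"
  shows "degree (\<Prod>x\<leftarrow>xs. f x) \<le> length xs * n"
proof -
  have "degree (\<Prod>x\<leftarrow>xs. f x) \<le> (\<Sum>x\<leftarrow>xs. degree (f x))"
    using degree_prod_list_le[of "map f xs"] by (simp add: o_def)
  also have "\<dots> \<le> (\<Sum>x\<leftarrow>xs. n)"
    using assms by (rule sum_list_mono)
  finally show ?thesis by (simp add: sum_list_triv)
qed

lemma poly_prod_list_map: "poly (\<Prod>x\<leftarrow>xs. f x) y = (\<Prod>x\<leftarrow>xs. poly (f x) y)"
  by (induction xs) simp_all

text \<open>With \<open>w = poly_at_infty p ^ (q ^ k)\<close> the numerator is a polynomial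
  \<open>P = c + w Q\<close> in \<open>w\<close>. The sum of \<open>Q\<close> over the translate
  vanishes, which leaves \<open>c / w\<close>.\<close>

lemma sum_monics_power_ratio:
  assumes len: "length xs < CARD('a)" and d: "d \<ge> 1"
  shows "(\<Sum>p\<in>(monics d :: 'a::{field,finite} poly set).
      (\<Prod>x\<leftarrow>xs. poly_at_infty p ^ (CARD('a) ^ x)) / poly_at_infty p ^ (CARD('a) ^ k)) =
    (\<Prod>x\<leftarrow>xs. node_product k d x) *
    (\<Sum>p\<in>(monics d :: 'a poly set). 1 / poly_at_infty p ^ (CARD('a) ^ k))"
proof -
  let ?q = "CARD('a)"
  let ?w = "\<lambda>p :: 'a poly. poly_at_infty p ^ (?q ^ k)"
  define f :: "nat \<Rightarrow> 'a fls poly" where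
    "f x = [:node_product k d x:] + (\<Sum>j<d. monom (lagrange_basis k d x j) (?q ^ j))" for x
  define P where "P = (\<Prod>x\<leftarrow>xs. f x)"
  have "degree (f x) \<le> ?q ^ (d - 1)" for x
    unfolding f_def using d two_le_card_field[where ?'a = 'a]
    by (intro degree_add_le degree_sum_le order_trans[OF degree_monom_le] power_increasing) auto
  hence "degree P \<le> length xs * ?q ^ (d - 1)"
    unfolding P_def by (intro degree_prod_list_le_const)
  \<comment> \<open>The strict bound on \<open>length xs\<close> keeps the degree below the number
    of points.\<close>
  also have "\<dots> < ?q * ?q ^ (d - 1)"
    using len by simp
  also have "\<dots> = ?q ^ d"
    using d by (cases d) simp_all
  finally have degP: "degree P < ?q ^ d" .
  obtain c Q where PQ: "P = pCons c Q" by (cases P)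
  \<comment> \<open>For \<open>Q = 0\<close> the degree of \<open>P\<close> is not
    \<open>degree Q + 1\<close>, and the bound reads \<open>1 < q ^ d\<close>.\<close>
  have "degree Q + 1 < ?q ^ d"
  proof (cases "Q = 0")
    case True
    have "1 < ?q ^ d"
      using d two_le_card_field[where ?'a = 'a] by (intro one_less_power) auto
    with True show ?thesis by simp
  qed (use degP in \<open>simp add: PQ\<close>)
  hence Q: "(\<Sum>p\<in>monics d. poly Q (?w p)) = 0"
    by (rule sum_poly_monics_eq_0)
  have f: "poly (f x) (?w p) = poly_at_infty p ^ (?q ^ x)" if "p \<in> monics d" for p x
    using power_card_interpolation_monics[OF that d, of x k]
    by (simp add: f_def poly_sum poly_monom)
  have "poly (f x) 0 = node_product k d x" for x
    by (simp add: f_def poly_sum poly_monom power_0_left)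
  hence c: "c = (\<Prod>x\<leftarrow>xs. node_product k d x)"
    using PQ by (metis (no_types, lifting) P_def map_eq_conv mult_zero_left poly_pCons poly_prod_list_map
        add.right_neutral)
  have "(\<Sum>p\<in>monics d. (\<Prod>x\<leftarrow>xs. poly_at_infty p ^ (?q ^ x)) / ?w p) =
      (\<Sum>p\<in>monics d. poly P (?w p) / ?w p)"
    by (intro sum.cong refl) (simp add: P_def poly_prod_list_map f)
  also have "\<dots> = (\<Sum>p\<in>monics d. c * (1 / ?w p) + poly Q (?w p))"
    by (intro sum.cong refl) (auto simp: PQ monics_def add_divide_distrib)
  also have "\<dots> = c * (\<Sum>p\<in>monics d. 1 / ?w p)"
    by (simp add: sum.distrib Q sum_distrib_left)
  finally show ?thesis by (simp add: c)
qed

text \<open>Without a constant term, each ratio is itself a polynomial in \<open>w\<close>. The sum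
  over the whole group vanishes, so the nonzero elements contribute minus the value at
  \<open>0\<close>.\<close>

lemma sum_nonzero_power_ratio:
  assumes len: "length xs \<le> CARD('a)" and d: "d \<ge> 1"
  shows "(\<Sum>p\<in>(polys_below d - {0} :: 'a::{field,finite} poly set).
      \<Prod>x\<leftarrow>xs. poly_at_infty p ^ (CARD('a) ^ x) / poly_at_infty p ^ (CARD('a) ^ k)) =
    - (\<Prod>x\<leftarrow>xs. lagrange_basis k d x 0)"
proof -
  let ?q = "CARD('a)"
  let ?w = "\<lambda>p :: 'a poly. poly_at_infty p ^ (?q ^ k)"
  define f :: "nat \<Rightarrow> 'a fls poly" where
    "f x = (\<Sum>j<d. monom (lagrange_basis k d x j) (?q ^ j - 1))" for x
  define P where "P = (\<Prod>x\<leftarrow>xs. f x)"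
  have q: "?q \<ge> 2"
    by (rule two_le_card_field)
  have "degree (f x) \<le> ?q ^ (d - 1) - 1" for x
    unfolding f_def using d q
    by (intro degree_sum_le order_trans[OF degree_monom_le] diff_le_mono power_increasing) auto
  hence "degree P \<le> length xs * (?q ^ (d - 1) - 1)"
    unfolding P_def by (intro degree_prod_list_le_const)
  \<comment> \<open>Division by \<open>w\<close> lowers the degree of each factor by one, so a list
    of length exactly \<open>q\<close> is still admissible.\<close>
  also have "\<dots> \<le> ?q * (?q ^ (d - 1) - 1)"
    using len by (rule mult_right_mono) simp
  also have "\<dots> = ?q ^ d - ?q"
    using d by (cases d) (simp_all add: diff_mult_distrib2)
  finally have "degree P \<le> ?q ^ d - ?q" .
  moreover have "?q ^ 1 \<le> ?q ^ d"
    using d q by (intro power_increasing) auto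
  ultimately have "degree P + 1 < ?q ^ d"
    using q by simp
  hence sum0: "(\<Sum>p\<in>polys_below d. poly P (?w p)) = 0"
    by (rule sum_poly_polys_below_eq_0)
  have f: "poly (f x) (?w p) = poly_at_infty p ^ (?q ^ x) / ?w p"
    if "p \<in> polys_below d" "p \<noteq> 0" for p x
  proof -
    have "?w p ^ (?q ^ j) = ?w p * ?w p ^ (?q ^ j - 1)" for j
      by (simp flip: power_Suc)
    hence "poly_at_infty p ^ (?q ^ x) = ?w p * poly (f x) (?w p)"
      using power_card_interpolation_polys_below[OF that(1) d, of x k]
      by (simp add: f_def poly_sum poly_monom sum_distrib_left mult_ac)
    thus ?thesis using that by simp
  qed
  \<comment> \<open>The exponent \<open>?q ^ j - 1\<close> is zero only for
    \<open>j = 0\<close>.\<close>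
  have "poly (f x) 0 = lagrange_basis k d x 0" for x
  proof -
    have "poly (f x) 0 = (\<Sum>j<d. if j = 0 then lagrange_basis k d x 0 else 0)"
      unfolding f_def poly_sum poly_monom
    proof (intro sum.cong refl)
      fix j
      have "?q ^ j - 1 > 0" if "j \<noteq> 0"
        using that q one_less_power[of ?q j] by simp
      thus "lagrange_basis k d x j * 0 ^ (?q ^ j - 1) =
          (if j = 0 then lagrange_basis k d x 0 else (0 :: 'a fls))"
        by (cases "j = 0") (simp_all only: power_0_left, simp_all)
    qed
    thus ?thesis using d by simp
  qed
  hence P0: "poly P 0 = (\<Prod>x\<leftarrow>xs. lagrange_basis k d x 0)"
    by (simp add: P_def poly_prod_list_map)
  have "0 \<in> polys_below d"
    by (simp add: polys_below_def)
  hence "poly P 0 + (\<Sum>p\<in>polys_below d - {0}. poly P (?w p)) = 0"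
    using sum0 sum.remove[of "polys_below d" 0 "\<lambda>p. poly P (?w p)"]
    by (simp add: power_0_left)
  moreover have "(\<Sum>p\<in>polys_below d - {0}. poly P (?w p)) =
      (\<Sum>p\<in>polys_below d - {0}. \<Prod>x\<leftarrow>xs. poly_at_infty p ^ (?q ^ x) / ?w p)"
    by (intro sum.cong refl) (simp add: P_def poly_prod_list_map f)
  ultimately show ?thesis
    by (simp add: P0 eq_neg_iff_add_eq_0 add.commute)
qed

text \<open>Every nonzero polynomial is uniquely a scalar times a monic one, and the number
  \<open>q - 1\<close> of scalars is \<open>-1\<close> in the field.\<close>

lemma sum_nonzero_homogeneous:
  fixes g :: "'a::{field,finite} poly \<Rightarrow> 'a fls"
  assumes hom: "\<And>c p. c \<noteq> 0 \<Longrightarrow> p \<noteq> 0 \<Longrightarrow> g (smult c p) = g p"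
  shows "(\<Sum>p\<in>polys_below d - {0}. g p) = - (\<Sum>p\<in>monics_below d. g p)"
proof -
  have "bij_betw (\<lambda>(c, p). smult c p) ((UNIV - {0}) \<times> monics_below d) (polys_below d - {0})"
    by (rule bij_betwI[where g = "\<lambda>p. (lead_coeff p, smult (inverse (lead_coeff p)) p)"])
       (auto simp: monics_below_def polys_below_iff_degree)
  hence "(\<Sum>p\<in>polys_below d - {0}. g p) =
      (\<Sum>(c, p)\<in>(UNIV - {0}) \<times> monics_below d. g (smult c p))"
    by (subst sum.reindex_bij_betw[symmetric]) (auto simp: case_prod_unfold)
  also have "\<dots> = (\<Sum>(c, p)\<in>(UNIV - {0 :: 'a}) \<times> monics_below d. g p)"
    by (rule sum.cong) (auto simp: monics_below_def intro!: hom)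
  also have "\<dots> = of_nat (CARD('a) - 1) * (\<Sum>p\<in>monics_below d. g p)"
    by (simp add: sum.cartesian_product[symmetric])
  also have "of_nat (CARD('a) - 1) = (- 1 :: 'a fls)"
    using two_le_card_field[where ?'a = 'a] by (simp add: of_nat_diff of_nat_card_fls)
  finally show ?thesis by simp
qed

text \<open>Scalars are fixed by the Frobenius map, so each ratio is invariant under scaling and the
  two minus signs cancel.\<close>

lemma sum_monics_below_power_ratio:
  assumes len: "length xs \<le> CARD('a)" and d: "d \<ge> 1"
  shows "(\<Sum>p\<in>(monics_below d :: 'a::{field,finite} poly set).
      \<Prod>x\<leftarrow>xs. poly_at_infty p ^ (CARD('a) ^ x) / poly_at_infty p ^ (CARD('a) ^ k)) =
    (\<Prod>x\<leftarrow>xs. lagrange_basis k d x 0)" (is "sum ?g _ = _")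
proof -
  have const: "fls_const c ^ (CARD('a) ^ m) = fls_const c" for c :: 'a and m
    by (simp add: finite_field_power_card_power flip: fls_const_power)
  have "sum ?g (polys_below d - {0}) = - sum ?g (monics_below d)"
    by (rule sum_nonzero_homogeneous) (simp add: poly_at_infty_smult power_mult_distrib const)
  thus ?thesis
    using sum_nonzero_power_ratio[OF assms, of k] by simp
qed

lemma lagrange_basis_0:
  assumes d: "d \<ge> 1"
  shows "lagrange_basis k d m 0 =
    (\<Prod>i\<in>{1..<d}. (t_pow m - t_pow (k + i)) / (t_pow k - t_pow (k + i)))"
proof -
  have "{..<d} - {0} = {1..<d}" using d by auto
  thus ?thesis by (simp add: lagrange_basis_def)
qed

text \<open>The factor \<open>i = 0\<close> splits off, and the others form the numerator of the
  basis value. This links the factors for \<open>ks\<close> to those for \<open>ls\<close>.\<close>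

lemma node_product_eq_lagrange_basis:
  assumes d: "d \<ge> 1"
  shows "node_product k d m =
    (t_pow m - t_pow k) * (\<Prod>i\<in>{1..<d}. t_pow k - t_pow (k + i)) * lagrange_basis k d m 0"
proof -
  have "{..<d} = insert 0 {1..<d}" using d by auto
  moreover have "(\<Prod>i\<in>{1..<d}. t_pow k - t_pow (k + i) :: 'a fls) \<noteq> 0"
    by auto
  ultimately show ?thesis
    by (simp add: node_product_def lagrange_basis_0[OF d] prod_dividef)
qed

text \<open>The new node contributes one factor, and that factor minus \<open>1\<close> is
  \<open>(t_pow m - t_pow k) / (t_pow k - t_pow (k + d))\<close>.\<close>

lemma lagrange_basis_Suc_diff:
  assumes d: "d \<ge> 1"
  shows "lagrange_basis k (Suc d) m 0 - lagrange_basis k d m 0 =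
    lagrange_basis k d m 0 * (t_pow m - t_pow k) / (t_pow k - t_pow (k + d))"
proof -
  have "{1..<Suc d} = insert d {1..<d}" using d by auto
  hence "lagrange_basis k (Suc d) m 0 =
      lagrange_basis k d m 0 * ((t_pow m - t_pow (k + d)) / (t_pow k - t_pow (k + d)))"
    using d by (simp add: lagrange_basis_0)
  moreover have "t_pow k - t_pow (k + d) \<noteq> (0 :: 'a fls)"
    using d by simp
  ultimately show ?thesis
    by (simp add: field_simps)
qed

text \<open>Comparing the two evaluations of the same sum over monic polynomials of degree \<open>d\<close>
  determines the reciprocal sum.\<close>

lemma node_product_times_reciprocal_sum:
  assumes d: "d \<ge> 1"
  shows "node_product k d m * (\<Sum>p\<in>(monics d :: 'a::{field,finite} poly set).
      1 / poly_at_infty p ^ (CARD('a) ^ k)) =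
    lagrange_basis k d m 0 * (t_pow m - t_pow k) / (t_pow k - t_pow (k + d))"
proof -
  let ?h = "\<lambda>p :: 'a poly. poly_at_infty p ^ (CARD('a) ^ m) / poly_at_infty p ^ (CARD('a) ^ k)"
  have q: "2 \<le> CARD('a)" by (rule two_le_card_field)
  have "node_product k d m * (\<Sum>p\<in>monics d. 1 / poly_at_infty p ^ (CARD('a) ^ k)) = sum ?h (monics d)"
    using sum_monics_power_ratio[of "[m]" d k, where ?'a = 'a] d q by simp
  also have "\<dots> = sum ?h (monics_below (Suc d)) - sum ?h (monics_below d)"
    by (simp add: monics_below_Suc
        sum.union_disjoint[OF finite_monics_below finite_monics monics_below_disjoint])
  also have "\<dots> = lagrange_basis k (Suc d) m 0 - lagrange_basis k d m 0"
    using sum_monics_below_power_ratio[of "[m]" _ k, where ?'a = 'a] d q by simp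
  finally show ?thesis
    by (simp only: lagrange_basis_Suc_diff[OF d])
qed

subsection \<open>The double sum\<close>

definition monic_power_sum :: "nat \<Rightarrow> nat \<Rightarrow> 'a::{field,finite} fls" where
  "monic_power_sum n d = (\<Sum>p\<in>monics d. 1 / poly_at_infty p ^ n)"

definition monic_power_sum_below :: "nat \<Rightarrow> nat \<Rightarrow> 'a::{field,finite} fls" where
  "monic_power_sum_below n d = (\<Sum>p\<in>monics_below d. 1 / poly_at_infty p ^ n)"

text \<open>The inequality ensures that the subtraction in the exponent is not truncated.\<close>

lemma inverse_power_eq_prod_list:
  fixes u :: "'b::field"
  assumes "u \<noteq> 0" "(\<Sum>x\<leftarrow>xs. q ^ x) \<le> m * q ^ k"
  shows "1 / u ^ (m * q ^ k - (\<Sum>x\<leftarrow>xs. q ^ x)) = (\<Prod>x\<leftarrow>xs. u ^ (q ^ x)) / (u ^ (q ^ k)) ^ m"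
proof -
  have "u ^ (\<Sum>x\<leftarrow>xs. q ^ x) = (\<Prod>x\<leftarrow>xs. u ^ (q ^ x))"
    by (induction xs) (simp_all add: power_add)
  moreover have "u ^ (m * q ^ k - (\<Sum>x\<leftarrow>xs. q ^ x)) * u ^ (\<Sum>x\<leftarrow>xs. q ^ x) = (u ^ (q ^ k)) ^ m"
    using assms(2) by (simp add: mult.commute flip: power_add power_mult)
  ultimately show ?thesis
    using assms(1) by (simp add: divide_simps mult_ac)
qed

lemma prod_list_divide_const:
  "(\<Prod>x\<leftarrow>xs. f x / c) = (\<Prod>x\<leftarrow>xs. f x) / (c :: 'b::field) ^ length xs"
  by (induction xs) simp_all

lemma monic_power_sum_eq:
  assumes "length xs < CARD('a)" "\<And>x. x \<in> set xs \<Longrightarrow> x < k" "k \<ge> 1" "d \<ge> 1"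
  shows "monic_power_sum (CARD('a) ^ k - (\<Sum>x\<leftarrow>xs. CARD('a) ^ x)) d =
    (\<Prod>x\<leftarrow>xs. node_product k d x) * (monic_power_sum (CARD('a) ^ k) d :: 'a::{field,finite} fls)"
proof -
  have "(\<Sum>x\<leftarrow>xs. CARD('a) ^ x) \<le> 1 * CARD('a) ^ k"
    using assms by (intro less_imp_le[OF sum_list_powers_less]) auto
  hence le: "(\<Sum>x\<leftarrow>xs. CARD('a) ^ x) \<le> CARD('a) ^ k" by simp
  have "monic_power_sum (CARD('a) ^ k - (\<Sum>x\<leftarrow>xs. CARD('a) ^ x)) d =
    (\<Sum>p\<in>(monics d :: 'a poly set).
      (\<Prod>x\<leftarrow>xs. poly_at_infty p ^ (CARD('a) ^ x)) / poly_at_infty p ^ (CARD('a) ^ k))"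
  proof (unfold monic_power_sum_def, intro sum.cong refl, goal_cases)
    case (1 p)
    hence "poly_at_infty p \<noteq> 0" by (auto simp: monics_def)
    thus ?case
      using le inverse_power_eq_prod_list[of "poly_at_infty p" "CARD('a)" xs 1 k] by simp
  qed
  also have "\<dots> = (\<Prod>x\<leftarrow>xs. node_product k d x) * monic_power_sum (CARD('a) ^ k) d"
    unfolding monic_power_sum_def using assms by (intro sum_monics_power_ratio) auto
  finally show ?thesis .
qed

text \<open>Each of the \<open>length ys\<close> copies of \<open>q ^ k\<close> is paired with one
  entry of \<open>ys\<close>, giving a product of ratios.\<close>

lemma monic_power_sum_below_eq:
  assumes "length ys \<le> CARD('a)" "\<And>y. y \<in> set ys \<Longrightarrow> y < k" "k \<ge> 1" "d \<ge> 1" "length ys \<ge> 1"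
  shows "monic_power_sum_below (length ys * CARD('a) ^ k - (\<Sum>y\<leftarrow>ys. CARD('a) ^ y)) d =
    (\<Prod>y\<leftarrow>ys. lagrange_basis k d y 0 :: 'a::{field,finite} fls)"
proof -
  have "length ys * 1 < length ys * CARD('a)"
    using assms two_le_card_field[where ?'a = 'a] by (intro mult_strict_left_mono) auto
  hence le: "(\<Sum>y\<leftarrow>ys. CARD('a) ^ y) \<le> length ys * CARD('a) ^ k"
    using assms by (intro less_imp_le[OF sum_list_powers_less]) auto
  have "1 / poly_at_infty p ^ (length ys * CARD('a) ^ k - (\<Sum>y\<leftarrow>ys. CARD('a) ^ y)) =
      (\<Prod>y\<leftarrow>ys. poly_at_infty p ^ (CARD('a) ^ y) / poly_at_infty p ^ (CARD('a) ^ k))"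
    if "p \<in> monics_below d" for p :: "'a poly"
    using that le unfolding prod_list_divide_const
    by (intro inverse_power_eq_prod_list) (auto simp: monics_below_def)
  thus ?thesis
    using sum_monics_below_power_ratio[of ys d k, where ?'a = 'a] assms
    by (simp add: monic_power_sum_below_def)
qed

section \<open>Limits coefficient by coefficient, and truncation of the double sum\<close>

text \<open>Distinct series have distance \<open>2\<close> to the power minus the subdegree of their
  difference, so a small distance forces many equal coefficients.\<close>

lemma fls_tendsto_nth_eventually:
  fixes X :: "'i \<Rightarrow> 'a::field fls"
  assumes "(X \<longlongrightarrow> Z) F"
  shows "\<forall>\<^sub>F N in F. \<forall>i\<le>n. fls_nth (X N - Z) i = 0"
proof -
  have "\<forall>\<^sub>F N in F. dist (X N) Z < inverse (2 ^ nat n)"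
    using assms by (rule tendstoD) simp
  thus ?thesis
  proof eventually_elim
    case (elim N)
    show ?case
    proof (cases "X N = Z")
      case False
      have "fls_subdegree (X N - Z) > n"
      proof (rule ccontr)
        assume neg: "\<not> ?thesis"
        have "inverse (2 ^ nat n) \<le> dist (X N) Z"
        proof (cases "fls_subdegree (X N - Z) \<ge> 0")
          case True
          with neg False show ?thesis
            by (simp add: dist_fls_def le_imp_inverse_le power_increasing nat_mono)
        next
          case neg_deg: False
          have "inverse (2 ^ nat n) \<le> (1 :: real)"
            by (simp add: inverse_le_1_iff)
          also have "1 \<le> (2 :: real) ^ nat (- fls_subdegree (X N - Z))"
            by simp
          finally show ?thesis
            using neg_deg False by (simp add: dist_fls_def)
        qed
        with elim show False by simp
      qed
      thus ?thesis by (intro allI impI fls_eq0_below_subdegree) linarith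
    qed simp
  qed
qed

text \<open>Multiplication by a nonzero \<open>R\<close> shifts subdegrees by that of
  \<open>R\<close>, so the previous bound is applied at the shifted index.\<close>

lemma fls_tendsto_mult_nth_eventually:
  fixes X :: "'i \<Rightarrow> 'a::field fls"
  assumes "(X \<longlongrightarrow> Z) F"
  shows "\<forall>\<^sub>F N in F. fls_nth (R * X N) n = fls_nth (R * Z) n"
  using fls_tendsto_nth_eventually[OF assms, of "n - fls_subdegree R"]
proof eventually_elim
  case (elim N)
  have "fls_nth (R * (X N - Z)) n = 0"
  proof (cases "R = 0 \<or> X N - Z = 0")
    case False
    hence "fls_subdegree (X N - Z) > n - fls_subdegree R"
      using elim by (intro fls_subdegree_greaterI) auto
    with False have "n < fls_subdegree (R * (X N - Z))"
      by simp
    thus ?thesis by (rule fls_eq0_below_subdegree)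
  qed auto
  thus ?case by (simp add: right_diff_distrib)
qed

text \<open>Raising \<open>N\<close> by one adds a product set of pairs. Since
  \<open>degree a1 > degree a2\<close> excludes \<open>degree a1 = 0\<close>, the outer sum starts
  at \<open>1\<close>.\<close>

lemma sum_pairs_degree_le:
  "(\<Sum>(a1, a2)\<in>{(a1, a2). lead_coeff a1 = 1 \<and> lead_coeff a2 = 1 \<and> degree a1 > degree a2 \<and> degree a1 \<le> N}.
      1 / (poly_at_infty a1 ^ s1 * poly_at_infty a2 ^ s2)) =
    (\<Sum>d\<in>{1..N}. monic_power_sum s1 d * (monic_power_sum_below s2 d :: 'a::{field,finite} fls))"
  (is "sum ?f (?I N) = ?r N")
  and finite_pairs_degree_le: "finite {(a1 :: 'a poly, a2 :: 'a poly).
    lead_coeff a1 = 1 \<and> lead_coeff a2 = 1 \<and> degree a1 > degree a2 \<and> degree a1 \<le> N}"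
proof -
  have step: "?I (Suc N) = ?I N \<union> monics (Suc N) \<times> monics_below (Suc N)" for N
    by (auto simp: monics_def monics_below_def le_Suc_eq)
  have zero: "?I 0 = {}" by auto
  have fin: "finite (?I N)" for N
    by (rule finite_subset[OF _ finite_cartesian_product[OF finite_degree_le[of N] finite_degree_le[of N]]])
      auto
  thus "finite (?I N)" .
  show "sum ?f (?I N) = ?r N"
  proof (induction N)
    case 0
    show ?case unfolding zero by simp
  next
    case (Suc N)
    have "sum ?f (?I (Suc N)) = sum ?f (?I N) + sum ?f (monics (Suc N) \<times> monics_below (Suc N))"
      unfolding step by (intro sum.union_disjoint fin) (simp, auto simp: monics_def)
    also have "sum ?f (monics (Suc N) \<times> monics_below (Suc N)) =
        monic_power_sum s1 (Suc N) * monic_power_sum_below s2 (Suc N)"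
      by (simp add: monic_power_sum_def monic_power_sum_below_def sum_product
          sum.cartesian_product)
    finally show ?case
      using Suc by simp
  qed
qed

text \<open>The finite sets of pairs with \<open>degree a1 \<le> N\<close> eventually contain any
  given finite set of pairs, so the unordered sum is the limit along them.\<close>

lemma zeta2_tendsto:
  assumes "s1 > 0"
  shows "(\<lambda>N. \<Sum>d\<in>{1..N}. monic_power_sum s1 d * monic_power_sum_below s2 d)
    \<longlonglongrightarrow> (zeta2 s1 s2 :: 'a::{field,finite} fls)"
proof -
  let ?f = "\<lambda>(a1 :: 'a poly, a2 :: 'a poly). 1 / (poly_at_infty a1 ^ s1 * poly_at_infty a2 ^ s2)"
  let ?A = "{(a1 :: 'a poly, a2 :: 'a poly). lead_coeff a1 = 1 \<and> lead_coeff a2 = 1 \<and> degree a1 > degree a2}"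
  let ?I = "\<lambda>N. {(a1 :: 'a poly, a2 :: 'a poly).
    lead_coeff a1 = 1 \<and> lead_coeff a2 = 1 \<and> degree a1 > degree a2 \<and> degree a1 \<le> N}"
  have "(sum ?f \<longlongrightarrow> zeta2 s1 s2) (finite_subsets_at_top ?A)"
    using has_sum_infsum[OF zeta2_summable[OF assms, of s2, where ?'a = 'a]]
    by (simp add: has_sum_def zeta2_def)
  moreover have "filterlim ?I (finite_subsets_at_top ?A) sequentially"
    unfolding filterlim_finite_subsets_at_top
  proof safe
    fix S assume S: "finite S" "S \<subseteq> ?A"
    \<comment> \<open>The inserted \<open>0\<close> makes the maximum meaningful for empty
      \<open>S\<close>.\<close>
    define N where "N = Max (insert 0 ((\<lambda>(a1, a2). degree a1) ` S))"
    have "degree a1 \<le> N" if "(a1, a2) \<in> S" for a1 a2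
      unfolding N_def using S that by (intro Max_ge) force+
    hence "S \<subseteq> ?I n" if "n \<ge> N" for n
      using S that by fastforce
    thus "\<forall>\<^sub>F n in sequentially. finite (?I n) \<and> S \<subseteq> ?I n \<and> ?I n \<subseteq> ?A"
      using finite_pairs_degree_le by (intro eventually_sequentiallyI[of N]) blast
  qed
  ultimately have "(\<lambda>N. sum ?f (?I N)) \<longlonglongrightarrow> zeta2 s1 s2"
    by (rule filterlim_compose)
  thus ?thesis
    by (simp only: sum_pairs_degree_le)
qed

section \<open>Symmetry in the entries of both lists\<close>

lemma prod_list_node_product:
  assumes d: "d \<ge> 1"
  shows "(\<Prod>y\<leftarrow>ys. node_product k d y) = (\<Prod>y\<leftarrow>ys. t_pow y - t_pow k) *
    (\<Prod>i\<in>{1..<d}. t_pow k - t_pow (k + i)) ^ length ys *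
    (\<Prod>y\<leftarrow>ys. lagrange_basis k d y 0 :: 'a::{field,finite} fls)"
  by (induction ys) (simp_all add: node_product_eq_lagrange_basis[OF d] mult_ac)

text \<open>The prefactor turns the basis values for \<open>ls\<close> into node products, up to a
  power depending only on \<open>k\<close>, \<open>d\<close> and \<open>length ls\<close>. The right
  side thus sees the entries only through the combined multiset.\<close>

lemma zeta2_term_symmetric:
  assumes d: "d \<ge> 1"
  assumes ks: "length ks < CARD('a)" "\<And>x. x \<in> set ks \<Longrightarrow> x < k" and k: "k \<ge> 1"
  assumes ls: "1 \<le> length ls" "length ls \<le> CARD('a)" "\<And>x. x \<in> set ls \<Longrightarrow> x < k"
  shows "(\<Prod>y\<leftarrow>ls. t_pow y - t_pow k) *
      (monic_power_sum (CARD('a) ^ k - (\<Sum>x\<leftarrow>ks. CARD('a) ^ x)) d *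
       monic_power_sum_below (length ls * CARD('a) ^ k - (\<Sum>x\<leftarrow>ls. CARD('a) ^ x)) d) =
    (\<Prod>x\<in>#mset ks + mset ls. node_product k d x) *
      monic_power_sum (CARD('a) ^ k) d /
      (\<Prod>i\<in>{1..<d}. t_pow k - t_pow (k + i) :: 'a::{field,finite} fls) ^ length ls"
proof -
  have "(\<Prod>i\<in>{1..<d}. t_pow k - t_pow (k + i) :: 'a fls) \<noteq> 0"
    by auto
  moreover have "(\<Prod>x\<in>#mset ks + mset ls. node_product k d x :: 'a fls) =
      (\<Prod>x\<leftarrow>ks. node_product k d x) * (\<Prod>x\<leftarrow>ls. node_product k d x)"
    by (simp add: prod_mset_prod_list flip: mset_map)
  ultimately show ?thesis
    using assms by (simp add: monic_power_sum_eq monic_power_sum_below_eq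
        prod_list_node_product[OF d, of k ls])
qed

text \<open>The partial sums agree term by term after multiplication by the prefactors; each
  coefficient of the limits is attained by the partial sums eventually.\<close>

lemma zeta2_symmetric:
  assumes k: "k \<ge> 1"
  assumes ks: "1 \<le> length ks" "length ks < CARD('a)" "\<And>x. x \<in> set ks \<Longrightarrow> x < k"
    and ls: "1 \<le> length ls" "length ls \<le> CARD('a)" "\<And>x. x \<in> set ls \<Longrightarrow> x < k"
    and len: "length ks' = length ks" "length ls' = length ls"
    and mset: "mset ks' + mset ls' = mset ks + mset ls"
  shows "(\<Prod>y\<leftarrow>ls. t_pow y - t_pow k) *
      (zeta2 (CARD('a) ^ k - (\<Sum>x\<leftarrow>ks. CARD('a) ^ x))
        (length ls * CARD('a) ^ k - (\<Sum>x\<leftarrow>ls. CARD('a) ^ x)) :: 'a::{field,finite} fls) =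
    (\<Prod>y\<leftarrow>ls'. t_pow y - t_pow k) *
      zeta2 (CARD('a) ^ k - (\<Sum>x\<leftarrow>ks'. CARD('a) ^ x))
        (length ls' * CARD('a) ^ k - (\<Sum>x\<leftarrow>ls'. CARD('a) ^ x))"
    (is "?R * zeta2 ?a ?b = ?R' * zeta2 ?a' ?b'")
proof (rule fls_eqI)
  fix n
  have "set ks' \<union> set ls' = set ks \<union> set ls"
    using mset by (metis set_mset_mset set_mset_union)
  hence ks': "\<And>x. x \<in> set ks' \<Longrightarrow> x < k" and ls': "\<And>x. x \<in> set ls' \<Longrightarrow> x < k"
    using ks(3) ls(3) by blast+
  let ?X = "\<lambda>a b N. \<Sum>d\<in>{1..N}. monic_power_sum a d * (monic_power_sum_below b d :: 'a fls)"
  have pos: "?a > 0" "?a' > 0"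
    using sum_list_powers_less[of "CARD('a)" k ks 1] sum_list_powers_less[of "CARD('a)" k ks' 1]
      k ks ks' len by simp_all
  have "?R * ?X ?a ?b N = ?R' * ?X ?a' ?b' N" for N
    unfolding sum_distrib_left
  proof (intro sum.cong refl)
    fix d assume "d \<in> {1..N}"
    hence d: "d \<ge> 1" by simp
    show "?R * (monic_power_sum ?a d * monic_power_sum_below ?b d) =
      ?R' * (monic_power_sum ?a' d * monic_power_sum_below ?b' d)"
      using zeta2_term_symmetric[where ?'a = 'a and ks = ks and ls = ls, OF d ks(2,3) k ls]
        zeta2_term_symmetric[where ?'a = 'a and ks = ks' and ls = ls', OF d _ ks' k _ _ ls'] ks ls len mset
      by simp
  qed
  moreover have "\<forall>\<^sub>F N in sequentially. fls_nth (?R * ?X ?a ?b N) n = fls_nth (?R * zeta2 ?a ?b) n"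
    by (intro fls_tendsto_mult_nth_eventually zeta2_tendsto pos)
  moreover have "\<forall>\<^sub>F N in sequentially.
      fls_nth (?R' * ?X ?a' ?b' N) n = fls_nth (?R' * zeta2 ?a' ?b') n"
    by (intro fls_tendsto_mult_nth_eventually zeta2_tendsto pos)
  ultimately have "\<forall>\<^sub>F N in sequentially :: nat filter.
      fls_nth (?R * zeta2 ?a ?b) n = fls_nth (?R' * zeta2 ?a' ?b') n"
    by (smt (verit) eventually_elim2)
  thus "fls_nth (?R * zeta2 ?a ?b) n = fls_nth (?R' * zeta2 ?a' ?b') n"
    by simp
qed

subsection \<open>Nonvanishing\<close>

lemma fls_subdegree_prod_field:
  fixes f :: "'i \<Rightarrow> 'b::field fls"
  assumes "\<And>x. x \<in> I \<Longrightarrow> f x \<noteq> 0"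
  shows "fls_subdegree (\<Prod>x\<in>I. f x) = (\<Sum>x\<in>I. fls_subdegree (f x))"
  using assms by (induction I rule: infinite_finite_induct) auto

lemma node_product_nonzero: "m < k \<Longrightarrow> node_product k d m \<noteq> 0"
  by (auto simp: node_product_def)

lemma fls_subdegree_node_product:
  assumes "m < k"
  shows "fls_subdegree (node_product k d m :: 'a::{field,finite} fls) =
    - int (\<Sum>i<d. CARD('a) ^ (k + i))"
proof -
  have "fls_subdegree (node_product k d m :: 'a fls) =
      (\<Sum>i<d. fls_subdegree (t_pow m - t_pow (k + i) :: 'a fls))"
    unfolding node_product_def using assms by (intro fls_subdegree_prod_field) auto
  thus ?thesis
    using assms by (simp add: fls_subdegree_t_pow_diff sum_negf)
qed

lemma lagrange_basis_0_nonzero: "d \<ge> 1 \<Longrightarrow> m < k \<Longrightarrow> lagrange_basis k d m 0 \<noteq> 0"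
  by (auto simp: lagrange_basis_0)

text \<open>In each quotient \<open>t_pow (k + i)\<close> with \<open>i \<ge> 1\<close> dominates
  both numerator and denominator.\<close>

lemma fls_subdegree_lagrange_basis_0:
  assumes "d \<ge> 1" "m < k"
  shows "fls_subdegree (lagrange_basis k d m 0 :: 'a::{field,finite} fls) = 0"
proof -
  let ?f = "\<lambda>i. (t_pow m - t_pow (k + i)) / (t_pow k - t_pow (k + i)) :: 'a fls"
  have "fls_subdegree (?f i) = 0" if "i \<in> {1..<d}" for i
    using assms that by (subst fls_divide_subdegree) (auto simp: fls_subdegree_t_pow_diff)
  moreover have "fls_subdegree (\<Prod>i\<in>{1..<d}. ?f i) = (\<Sum>i\<in>{1..<d}. fls_subdegree (?f i))"
    using assms by (intro fls_subdegree_prod_field) auto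
  ultimately show ?thesis
    by (simp add: lagrange_basis_0[OF assms(1)])
qed

lemma fls_subdegree_prod_list:
  fixes f :: "'i \<Rightarrow> 'b::field fls"
  assumes "\<And>x. x \<in> set xs \<Longrightarrow> f x \<noteq> 0 \<and> fls_subdegree (f x) = c"
  shows "(\<Prod>x\<leftarrow>xs. f x) \<noteq> 0 \<and> fls_subdegree (\<Prod>x\<leftarrow>xs. f x) = int (length xs) * c"
  using assms by (induction xs) (simp_all add: algebra_simps)

text \<open>The geometric sum, arranged without subtraction on natural numbers.\<close>

lemma sum_powers_times: "(\<Sum>i<d. q ^ (k + i)) * q + q ^ k = (\<Sum>i<d. q ^ (k + i)) + (q :: nat) ^ (k + d)"
  by (induction d) (simp_all add: algebra_simps)

text \<open>One entry of \<open>ks\<close> is combined with the reciprocal sum, whose product with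
  its node product is known in closed form. With \<open>B\<close> the geometric sum, this part has
  subdegree \<open>(q - 1) B\<close> and each remaining entry adds \<open>- B\<close>.\<close>

lemma monic_power_sum_subdegree:
  assumes ks: "1 \<le> length ks" "length ks < CARD('a)" "\<And>x. x \<in> set ks \<Longrightarrow> x < k"
    and k: "k \<ge> 1" and d: "d \<ge> 1"
  defines "S \<equiv> monic_power_sum (CARD('a) ^ k - (\<Sum>x\<leftarrow>ks. CARD('a) ^ x)) d :: 'a::{field,finite} fls"
  shows "S \<noteq> 0 \<and>
    fls_subdegree S = (int CARD('a) - int (length ks)) * int (\<Sum>i<d. CARD('a) ^ (k + i))"
proof -
  let ?B = "\<Sum>i<d. CARD('a) ^ (k + i)"
  obtain x xs where ks_eq: "ks = x # xs"
    using ks(1) by (cases ks) auto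
  have x: "x < k" using ks(3) ks_eq by simp
  define u where "u = lagrange_basis k d x 0 * (t_pow x - t_pow k) / (t_pow k - t_pow (k + d) :: 'a fls)"
  define v where "v = (\<Prod>y\<leftarrow>xs. node_product k d y :: 'a fls)"
  have "S = (\<Prod>x\<leftarrow>ks. node_product k d x) * monic_power_sum (CARD('a) ^ k) d"
    unfolding S_def using ks k d by (intro monic_power_sum_eq)
  hence "S = v * (node_product k d x * monic_power_sum (CARD('a) ^ k) d)"
    by (simp add: ks_eq v_def mult_ac)
  hence S: "S = v * u"
    unfolding monic_power_sum_def node_product_times_reciprocal_sum[OF d] u_def .
  have v: "v \<noteq> 0 \<and> fls_subdegree v = int (length xs) * - int ?B"
    unfolding v_def using ks(3) ks_eq
    by (intro fls_subdegree_prod_list) (auto simp: node_product_nonzero fls_subdegree_node_product)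
  have nz: "lagrange_basis k d x 0 \<noteq> (0 :: 'a fls)" "t_pow x - t_pow k \<noteq> (0 :: 'a fls)"
      "t_pow k - t_pow (k + d) \<noteq> (0 :: 'a fls)"
    using x d by (auto simp: lagrange_basis_0_nonzero)
  have "fls_subdegree u = int (CARD('a) ^ (k + d)) - int (CARD('a) ^ k)"
    unfolding u_def using nz x d
    by (simp add: fls_divide_subdegree fls_subdegree_lagrange_basis_0 fls_subdegree_t_pow_diff
        del: right_minus_eq of_nat_power)
  also have "\<dots> = int ?B * int CARD('a) - int ?B"
    using arg_cong[OF sum_powers_times[where q = "CARD('a)" and k = k and d = d], of int]
    by (simp only: of_nat_add of_nat_mult)
  finally have "fls_subdegree u = int ?B * int CARD('a) - int ?B" .
  moreover have "u \<noteq> 0"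
    unfolding u_def using nz by simp
  ultimately show ?thesis
    using v by (simp add: S ks_eq algebra_simps del: of_nat_sum)
qed

text \<open>The \<open>d\<close>-th term has subdegree \<open>m d\<close>, and
  \<open>m 1 < m d\<close> for \<open>d > 1\<close> because \<open>length ks < q\<close>. So the
  leading coefficient of the first term survives in every partial sum and in the limit.\<close>

lemma zeta2_nonzero:
  assumes k: "k \<ge> 1"
  assumes ks: "1 \<le> length ks" "length ks < CARD('a)" "\<And>x. x \<in> set ks \<Longrightarrow> x < k"
    and ls: "1 \<le> length ls" "length ls \<le> CARD('a)" "\<And>x. x \<in> set ls \<Longrightarrow> x < k"
  shows "(zeta2 (CARD('a) ^ k - (\<Sum>x\<leftarrow>ks. CARD('a) ^ x))
    (length ls * CARD('a) ^ k - (\<Sum>x\<leftarrow>ls. CARD('a) ^ x)) :: 'a::{field,finite} fls) \<noteq> 0"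
    (is "zeta2 ?a ?b \<noteq> 0")
proof
  assume zero: "zeta2 ?a ?b = (0 :: 'a fls)"
  define T where "T d = monic_power_sum ?a d * (monic_power_sum_below ?b d :: 'a fls)" for d
  define B where "B d = (\<Sum>i<d. CARD('a) ^ (k + i))" for d
  define m where "m d = (int CARD('a) - int (length ks)) * int (B d)" for d
  have T: "T d \<noteq> 0 \<and> fls_subdegree (T d) = m d" if d: "d \<ge> 1" for d
  proof -
    have "monic_power_sum_below ?b d = (\<Prod>y\<leftarrow>ls. lagrange_basis k d y 0 :: 'a fls)"
      using ls k d by (intro monic_power_sum_below_eq) auto
    moreover have "\<dots> \<noteq> 0 \<and> fls_subdegree \<dots> = int (length ls) * 0"
      using ls d by (intro fls_subdegree_prod_list)
        (auto simp: lagrange_basis_0_nonzero fls_subdegree_lagrange_basis_0)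
    ultimately show ?thesis
      using monic_power_sum_subdegree[OF ks k d] by (simp add: T_def m_def B_def del: of_nat_sum)
  qed
  have "B 1 < B d" if "d > 1" for d
    unfolding B_def using that two_le_card_field[where ?'a = 'a]
    by (intro sum_strict_mono2[where b = 1]) auto
  hence m: "m 1 < m d" if "d > 1" for d
    using that ks(2) by (simp add: m_def)
  have "fls_nth (\<Sum>d\<in>{1..N}. T d) (m 1) = fls_nth (T 1) (m 1)" if "N \<ge> 1" for N
  proof -
    have "fls_nth (T d) (m 1) = 0" if "d > 1" for d
      using T[of d] m[OF that] that by (intro fls_eq0_below_subdegree) simp
    moreover have "{1..N} = insert 1 {2..N}" using that by auto
    ultimately show ?thesis by (simp add: fls_nth_sum)
  qed
  hence "\<forall>\<^sub>F N in sequentially. fls_nth (\<Sum>d\<in>{1..N}. T d) (m 1) = fls_nth (T 1) (m 1)"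
    by (intro eventually_sequentiallyI[of 1])
  moreover have "?a > 0"
    using sum_list_powers_less[of "CARD('a)" k ks 1] k ks by simp
  hence "(\<lambda>N. \<Sum>d\<in>{1..N}. T d) \<longlonglongrightarrow> 0"
    using zeta2_tendsto[of ?a ?b, where ?'a = 'a] by (simp add: T_def zero)
  from fls_tendsto_mult_nth_eventually[OF this, of 1 "m 1"]
  have "\<forall>\<^sub>F N in sequentially. fls_nth (\<Sum>d\<in>{1..N}. T d) (m 1) = 0"
    by simp
  ultimately have "\<forall>\<^sub>F N in sequentially :: nat filter. fls_nth (T 1) (m 1) = 0"
    by eventually_elim simp
  hence "fls_nth (T 1) (m 1) = 0" by simp
  thus False
    using T[of 1] nth_fls_subdegree_nonzero[of "T 1"] by simp
qed

text \<open>This makes the prefactors polynomials in \<open>t\<close>, hence their quotient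
  rational.\<close>

lemma prod_list_t_pow_diff:
  "(\<Prod>y\<leftarrow>ys. t_pow y - t_pow k :: 'a::{field,finite} fls) =
    poly_at_infty (\<Prod>y\<leftarrow>ys. [:0, 1:] ^ (CARD('a) ^ y) - [:0, 1:] ^ (CARD('a) ^ k))"
  by (simp add: poly_at_infty_prod_list poly_at_infty_diff poly_at_infty_power poly_at_infty_X
      t_pow_def)

text \<open>Division by zero yields \<open>0\<close>, which is rational, so nonvanishing of the
  denominator is stated as well. The multiset equation expresses that \<open>ks'\<close> and
  \<open>ls'\<close> redistribute the entries of \<open>ks\<close> and \<open>ls\<close>.\<close>

theorem theorem2:
  fixes q k s1 s2 a b a' b' :: nat
    and ks ls ks' ls' :: "nat list"
  assumes "q = CARD('a::{field,finite})"
    and "k \<ge> 1"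
    and "1 \<le> s1" "s1 < q"
    and "1 \<le> s2" "s2 \<le> q"
    and "length ks = s1" "\<And>x. x \<in> set ks \<Longrightarrow> x < k"
    and "length ls = s2" "\<And>x. x \<in> set ls \<Longrightarrow> x < k"
    and "a = q ^ k - (\<Sum>x\<leftarrow>ks. q ^ x)"
    and "b = s2 * q ^ k - (\<Sum>x\<leftarrow>ls. q ^ x)"
    and "length ks' = s1" "length ls' = s2" "mset ks' + mset ls' = mset ks + mset ls"
    and "a' = q ^ k - (\<Sum>x\<leftarrow>ks'. q ^ x)"
    and "b' = s2 * q ^ k - (\<Sum>x\<leftarrow>ls'. q ^ x)"
  shows "(zeta2 a' b' :: 'a fls) \<noteq> 0 \<and> (zeta2 a b :: 'a fls) / zeta2 a' b' \<in> rational_fls"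
proof
  have "set ks' \<union> set ls' = set ks \<union> set ls"
    using assms(15) by (metis set_mset_mset set_mset_union)
  hence ks': "\<And>x. x \<in> set ks' \<Longrightarrow> x < k" and ls': "\<And>x. x \<in> set ls' \<Longrightarrow> x < k"
    using assms(8,10) by blast+
  show nz: "(zeta2 a' b' :: 'a fls) \<noteq> 0"
    using zeta2_nonzero[of k ks' ls', where ?'a = 'a] assms ks' ls' by simp
  define G where "G = (\<lambda>ys. \<Prod>y\<leftarrow>ys. [:0, 1 :: 'a:] ^ (q ^ y) - [:0, 1:] ^ (q ^ k))"
  have G: "poly_at_infty (G ys) = (\<Prod>y\<leftarrow>ys. t_pow y - t_pow k)" for ys
    unfolding G_def assms(1) by (rule prod_list_t_pow_diff[symmetric])
  \<comment> \<open>A factor vanishes only for \<open>y = k\<close>, while all entries lie below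
    \<open>k\<close>.\<close>
  have "(\<Prod>y\<leftarrow>ls. t_pow y - t_pow k :: 'a fls) \<noteq> 0"
    using assms(10)[of k] by (auto simp: prod_list_zero_iff)
  hence "G ls \<noteq> 0"
    by (metis G poly_at_infty_eq_0_iff)
  moreover have "poly_at_infty (G ls) * zeta2 a b = poly_at_infty (G ls') * zeta2 a' b'"
    using zeta2_symmetric[of k ks ls ks' ls', where ?'a = 'a] assms unfolding G by simp
  ultimately have "zeta2 a b / zeta2 a' b' = poly_at_infty (G ls') / poly_at_infty (G ls)"
    using nz by (simp add: field_simps)
  thus "(zeta2 a b :: 'a fls) / zeta2 a' b' \<in> rational_fls"
    using \<open>G ls \<noteq> 0\<close> unfolding rational_fls_def by blast
qed

end
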